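(* In the consistent expiration streaming model with $n$ items and error parameter $\varepsilon\in(0,1/2]$, one can maintain, storing $\mathcal{O}(1/\varepsilon)$ words, an estimate $\hat n_{\mathrm{now}}$ of the number $n_{\mathrm{now}}$ of currently active (inserted and not yet expired) items such that $\hat n_{\mathrm{now}}\le n_{\mathrm{now}}\le\hat n_{\mathrm{now}}+\varepsilon n$.
   Context: Expiration streaming model: the stream is a sequence of items $x_1,\dots,x_n$, each with insertion time $S(x_i)$ and expiration time $E(x_i)>S(x_i)$ (possibly $\infty$), with $S(x_1)\le\dots\le S(x_n)$; item $x$ is active at time $t$ iff $S(x)\le t<E(x)$. The stream has consistent expirations if additionally $E(x_1)\le\dots\le E(x_n)$. Space is measured in words, each storing a time value or a counter in $[\mathrm{poly}(n)]$. *)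

theory Defs
  imports Complex_Main "HOL-Library.Extended_Real" "HOL-Computational_Algebra.Polynomial"
begin

(* Counting only needs the two times of an item, so any further payload is omitted. *)
datatype item = Item (ins: real) (expi: ereal)

definition active :: "item \<Rightarrow> real \<Rightarrow> bool" where
  "active x t \<longleftrightarrow> ins x \<le> t \<and> ereal t < expi x"

definition expiration_stream :: "item list \<Rightarrow> bool" where
  "expiration_stream xs \<longleftrightarrow>
     (\<forall>x\<in>set xs. ereal (ins x) < expi x) \<and> sorted (map ins xs)"

definition consistent_stream :: "item list \<Rightarrow> bool" where
  "consistent_stream xs \<longleftrightarrow> expiration_stream xs \<and> sorted (map expi xs)"

definition n_active :: "item list \<Rightarrow> real \<Rightarrow> nat" where
  "n_active xs t = card {i. i < length xs \<and> active (xs ! i) t}"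

datatype word = Time ereal | Counter nat

(* The whole memory is a list of words. An insertion sees only the arriving item (whose
   insertion time is the current time) and the old memory; the estimate is computed from
   the memory and the current time. *)
record streaming_alg =
  init :: "word list"
  insertion :: "item \<Rightarrow> word list \<Rightarrow> word list"
  estimate :: "word list \<Rightarrow> real \<Rightarrow> nat"

definition memory :: "streaming_alg \<Rightarrow> item list \<Rightarrow> word list" where
  "memory A xs = fold (insertion A) xs (init A)"

(* The estimate reported at time t while the stream xs is being processed: the memory then
   reflects exactly the items inserted up to time t, which form a prefix of xs. *)
definition estimate_at :: "streaming_alg \<Rightarrow> item list \<Rightarrow> real \<Rightarrow> nat" where
  "estimate_at A xs t = estimate A (memory A (takeWhile (\<lambda>x. ins x \<le> t) xs)) t"

definition stream_times :: "item list \<Rightarrow> ereal set" where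
  "stream_times xs = (\<lambda>x. ereal (ins x)) ` set xs \<union> expi ` set xs"

(* A word is a time value of an item seen so far or a counter of value at most N.
   An arbitrary extended real is not allowed as a word, since a single one could encode
   the entire history. *)
fun admissible_word :: "item list \<Rightarrow> nat \<Rightarrow> word \<Rightarrow> bool" where
  "admissible_word seen N (Time \<tau>) \<longleftrightarrow> \<tau> \<in> stream_times seen"
| "admissible_word seen N (Counter k) \<longleftrightarrow> k \<le> N"

(* Throughout the processing of xs, at most s words are stored, with counters at most N. *)
definition space_bounded :: "streaming_alg \<Rightarrow> item list \<Rightarrow> real \<Rightarrow> nat \<Rightarrow> bool" where
  "space_bounded A xs s N \<longleftrightarrow>
     (\<forall>i\<le>length xs.
        real (length (memory A (take i xs))) \<le> s \<and>
        (\<forall>w\<in>set (memory A (take i xs)). admissible_word (take i xs) N w))"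

end

theory Submission
  imports Defs "HOL-Library.Discrete_Functions"
begin

text \<open>
  After \<open>m\<close> insertions, keep \<open>m\<close> and the expiration time of every \<open>d\<close>-th item, where \<open>d\<close> is the
  largest power of two not exceeding \<open>max 1 (\<epsilon> m)\<close>. Since \<open>d\<close> only ever changes to a multiple of itself, the
  checkpoints needed after an insertion are among those already stored, except possibly the new item.
  Consistency makes the expired items a prefix of the stream, so the stored checkpoints reveal
  their number up to an error of \<open>d - 1\<close>.
\<close>

section \<open>Power-of-two checkpoint spacing\<close>

text \<open>As \<open>floor_log 0 = 0\<close>, the spacing is 1 while
  \<open>\<epsilon> * m < 1\<close>, so every item is then a checkpoint.\<close>

definition spacing :: "real \<Rightarrow> nat \<Rightarrow> nat" where
  "spacing \<epsilon> m = 2 ^ floor_log (nat \<lfloor>\<epsilon> * real m\<rfloor>)"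

lemma spacing_pos [simp]: "0 < spacing \<epsilon> m"
  by (simp add: spacing_def)

text \<open>The reason for rounding to powers of two: a growing exponent gives divisibility, which a
  growing \<open>\<lfloor>\<epsilon> * m\<rfloor>\<close> would not.\<close>

lemma spacing_dvd_Suc:
  assumes "0 \<le> \<epsilon>"
  shows "spacing \<epsilon> m dvd spacing \<epsilon> (Suc m)"
proof -
  have "nat \<lfloor>\<epsilon> * real m\<rfloor> \<le> nat \<lfloor>\<epsilon> * real (Suc m)\<rfloor>"
    using assms by (intro nat_mono floor_mono mult_left_mono) auto
  then show ?thesis
    unfolding spacing_def by (intro le_imp_power_dvd floor_log_le_iff)
qed

lemma spacing_upper:
  assumes "0 \<le> \<epsilon>"
  shows "real (spacing \<epsilon> m) \<le> \<epsilon> * real m + 1"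
proof (cases "nat \<lfloor>\<epsilon> * real m\<rfloor> = 0")
  case True
  then show ?thesis using assms by (simp add: spacing_def)
next
  case False
  then have "spacing \<epsilon> m \<le> nat \<lfloor>\<epsilon> * real m\<rfloor>"
    unfolding spacing_def by (intro floor_log_exp2_le) simp
  then show ?thesis using False by linarith
qed

lemma spacing_lower: "\<epsilon> * real m < 2 * real (spacing \<epsilon> m)"
proof -
  have "nat \<lfloor>\<epsilon> * real m\<rfloor> < 2 * spacing \<epsilon> m"
    unfolding spacing_def by (rule floor_log_exp2_gt)
  \<comment> \<open>Both sides are integers, so twice the spacing is at least the floor plus 1,
    which exceeds \<open>\<epsilon> * m\<close>.\<close>
  then show ?thesis by linarith
qed

section \<open>The checkpoint memory and its update\<close>

definition summary :: "real \<Rightarrow> item list \<Rightarrow> word list" where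
  "summary \<epsilon> xs = (let m = length xs; d = spacing \<epsilon> m in
     Counter m # map (\<lambda>j. Time (expi (xs ! (Suc j * d - 1)))) [0..<m div d])"

text \<open>Both spacings are recomputed from the counter. Counting items from 1, position
  \<open>Suc j * d'\<close> held old checkpoint number \<open>Suc j * d' div d\<close>, stored one
  index lower.\<close>

fun summary_insert :: "real \<Rightarrow> item \<Rightarrow> word list \<Rightarrow> word list" where
  "summary_insert \<epsilon> x (Counter m # ts) = (let d = spacing \<epsilon> m; d' = spacing \<epsilon> (Suc m) in
     Counter (Suc m) #
       map (\<lambda>j. if Suc j * d' = Suc m then Time (expi x) else ts ! (Suc j * d' div d - 1))
         [0..<Suc m div d'])"
| "summary_insert \<epsilon> x _ = []"

fun expired_word :: "real \<Rightarrow> word \<Rightarrow> bool" where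
  "expired_word t (Time \<tau>) \<longleftrightarrow> \<tau> \<le> ereal t"
| "expired_word t (Counter k) \<longleftrightarrow> False"

text \<open>With \<open>c\<close> expired checkpoints, at most \<open>Suc c * d - 1\<close> items
  have expired. Subtracting this worst case from \<open>m\<close> gives an underestimate; truncation
  at 0 is harmless.\<close>

fun summary_estimate :: "real \<Rightarrow> word list \<Rightarrow> real \<Rightarrow> nat" where
  "summary_estimate \<epsilon> (Counter m # ts) t =
     Suc m - Suc (length (filter (expired_word t) ts)) * spacing \<epsilon> m"
| "summary_estimate \<epsilon> _ t = 0"

definition checkpoint_alg :: "real \<Rightarrow> streaming_alg" where
  "checkpoint_alg \<epsilon> =
     \<lparr>init = [Counter 0], insertion = summary_insert \<epsilon>, estimate = summary_estimate \<epsilon>\<rparr>"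

lemma summary_insert_summary:
  assumes "0 \<le> \<epsilon>"
  shows "summary_insert \<epsilon> x (summary \<epsilon> xs) = summary \<epsilon> (xs @ [x])"
proof -
  define m where "m = length xs"
  define d where "d = spacing \<epsilon> m"
  define d' where "d' = spacing \<epsilon> (Suc m)"
  have pos: "0 < d" "0 < d'" by (simp_all add: d_def d'_def)
  have "d dvd d'" unfolding d_def d'_def by (rule spacing_dvd_Suc[OF assms])
  have step: "(if Suc j * d' = Suc m then Time (expi x)
        else map (\<lambda>j. Time (expi (xs ! (Suc j * d - 1)))) [0..<m div d] ! (Suc j * d' div d - 1))
      = Time (expi ((xs @ [x]) ! (Suc j * d' - 1)))"
    if j: "j < Suc m div d'" for j
  proof (cases "Suc j * d' = Suc m")
    case True
    then show ?thesis by (simp add: m_def nth_append)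
  next
    case False
    obtain q where q: "Suc j * d' = q * d"
      using \<open>d dvd d'\<close> by (metis dvd_def dvd_mult mult.commute)
    have "Suc j * d' \<le> Suc m"
      using j pos by (metis Suc_leI less_eq_div_iff_mult_less_eq)
    \<comment> \<open>The position lies among the old items and is a positive multiple of
      \<open>d\<close>, so it is an old checkpoint; \<open>q = Suc r\<close> makes the index
      \<open>q - 1\<close> genuine.\<close>
    with False have le: "q * d \<le> m" using q by simp
    then obtain r where r: "q = Suc r" using q pos by (cases q) auto
    have "q \<le> m div d" using le pos by (simp add: less_eq_div_iff_mult_less_eq)
    moreover have "q * d - 1 < length xs"
      using le pos unfolding m_def[symmetric] r by simp
    ultimately show ?thesis
      using False pos unfolding q r by (simp add: nth_append)
  qed
  have "map (\<lambda>j. if Suc j * d' = Suc m then Time (expi x)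
        else map (\<lambda>j. Time (expi (xs ! (Suc j * d - 1)))) [0..<m div d] ! (Suc j * d' div d - 1))
        [0..<Suc m div d']
      = map (\<lambda>j. Time (expi ((xs @ [x]) ! (Suc j * d' - 1)))) [0..<Suc m div d']"
    by (rule map_cong[OF refl step]) simp
  then show ?thesis
    by (simp only: summary_def Let_def summary_insert.simps length_append_singleton
        m_def d_def d'_def)
qed

lemma memory_checkpoint_alg:
  assumes "0 \<le> \<epsilon>"
  shows "memory (checkpoint_alg \<epsilon>) xs = summary \<epsilon> xs"
proof (induction xs rule: rev_induct)
  case Nil
  then show ?case by (simp add: memory_def checkpoint_alg_def summary_def)
next
  case (snoc x xs)
  then show ?case
    using summary_insert_summary[OF assms, of x xs] by (simp add: memory_def checkpoint_alg_def)
qed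

section \<open>Space bound\<close>

lemma length_summary:
  assumes "0 < \<epsilon>" "\<epsilon> \<le> 1"
  shows "real (length (summary \<epsilon> xs)) \<le> 3 / \<epsilon>"
proof -
  define d where "d = spacing \<epsilon> (length xs)"
  have "0 < d" by (simp add: d_def)
  have "real (length xs div d) \<le> real (length xs) / real d"
    by (rule of_nat_div_le_of_nat)
  also have "\<dots> \<le> 2 / \<epsilon>"
    using spacing_lower[of \<epsilon> "length xs"] assms(1) \<open>0 < d\<close>
    by (simp add: d_def[symmetric] field_simps)
  finally have "real (length xs div d) \<le> 2 / \<epsilon>" .
  \<comment> \<open>The counter word is charged to a third \<open>1 / \<epsilon>\<close>.\<close>
  moreover have "1 \<le> 1 / \<epsilon>" using assms by simp
  moreover have "3 / \<epsilon> = 1 / \<epsilon> + 2 / \<epsilon>" by (simp add: add_divide_distrib[symmetric])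
  ultimately show ?thesis by (simp add: summary_def Let_def d_def[symmetric])
qed

lemma admissible_summary:
  assumes "w \<in> set (summary \<epsilon> xs)" "length xs \<le> N"
  shows "admissible_word xs N w"
proof -
  define d where "d = spacing \<epsilon> (length xs)"
  have "0 < d" by (simp add: d_def)
  consider "w = Counter (length xs)"
    | j where "j < length xs div d" "w = Time (expi (xs ! (Suc j * d - 1)))"
    using assms(1) by (auto simp: summary_def Let_def d_def)
  then show ?thesis
  proof cases
    case 1
    then show ?thesis using assms(2) by simp
  next
    case 2
    have "Suc j * d \<le> length xs"
      using 2(1) \<open>0 < d\<close> by (metis Suc_leI less_eq_div_iff_mult_less_eq)
    then have "Suc j * d - 1 < length xs" using \<open>0 < d\<close> by (simp add: Suc_le_eq[symmetric])
    then show ?thesis unfolding 2(2) by (auto simp: stream_times_def)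
  qed
qed

section \<open>Accuracy of the estimate\<close>

lemma filter_le_eq_takeWhile:
  fixes f :: "'a \<Rightarrow> 'b::linorder"
  assumes "sorted (map f xs)"
  shows "filter (\<lambda>x. f x \<le> b) xs = takeWhile (\<lambda>x. f x \<le> b) xs"
  using assms
proof (induction xs)
  case (Cons x xs)
  show ?case
  proof (cases "f x \<le> b")
    case True
    then show ?thesis using Cons by simp
  next
    case False
    then have "\<forall>y\<in>set (x # xs). \<not> f y \<le> b" using Cons.prems by fastforce
    then show ?thesis by (simp add: filter_empty_conv)
  qed
qed simp

text \<open>Sortedness puts the keys up to \<open>b\<close> first. Applied to \<open>expi\<close>,
  it lets one checkpoint compare its position with the number of expired items.\<close>

lemma nth_le_iff_less_length_filter:
  fixes f :: "'a \<Rightarrow> 'b::linorder"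
  assumes "sorted (map f xs)" "i < length xs"
  shows "f (xs ! i) \<le> b \<longleftrightarrow> i < length (filter (\<lambda>x. f x \<le> b) xs)"
  using assms
proof (induction xs arbitrary: i)
  case (Cons x xs)
  show ?case
  proof (cases "f x \<le> b")
    case True
    then show ?thesis using Cons by (cases i) auto
  next
    case False
    then have "\<forall>y\<in>set (x # xs). \<not> f y \<le> b" using Cons.prems(1) by fastforce
    then show ?thesis using Cons.prems(2) by (metis filter_False length_0_conv not_less_zero nth_mem)
  qed
qed simp

text \<open>The checkpoint at position \<open>Suc j * d\<close> has expired iff
  \<open>Suc j * d \<le> k\<close>, that is \<open>j < k div d\<close>; hence exactly
  \<open>k div d\<close> checkpoints have expired.\<close>

lemma summary_estimate_summary:
  assumes "sorted (map expi xs)"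
  shows "summary_estimate \<epsilon> (summary \<epsilon> xs) t =
    (let d = spacing \<epsilon> (length xs); k = length (filter (\<lambda>x. expi x \<le> ereal t) xs) in
     Suc (length xs) - Suc (k div d) * d)"
proof -
  define d where "d = spacing \<epsilon> (length xs)"
  define k where "k = length (filter (\<lambda>x. expi x \<le> ereal t) xs)"
  have "0 < d" by (simp add: d_def)
  have "k div d \<le> length xs div d" unfolding k_def by (intro div_le_mono length_filter_le)
  have "expi (xs ! (Suc j * d - 1)) \<le> ereal t \<longleftrightarrow> j < k div d" if "j < length xs div d" for j
  proof -
    have "Suc j * d \<le> length xs"
      using that \<open>0 < d\<close> by (metis Suc_leI less_eq_div_iff_mult_less_eq)
    then have "Suc j * d - 1 < length xs" using \<open>0 < d\<close> by (simp add: Suc_le_eq[symmetric])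
    then have "expi (xs ! (Suc j * d - 1)) \<le> ereal t \<longleftrightarrow> Suc j * d - 1 < k"
      unfolding k_def by (rule nth_le_iff_less_length_filter[OF assms])
    also have "\<dots> \<longleftrightarrow> Suc j * d \<le> k" using \<open>0 < d\<close> by (auto simp: Suc_le_eq[symmetric])
    also have "\<dots> \<longleftrightarrow> j < k div d"
      using \<open>0 < d\<close> by (metis Suc_le_eq less_eq_div_iff_mult_less_eq)
    finally show ?thesis .
  qed
  then have "{j. j < length xs div d \<and> expi (xs ! (Suc j * d - 1)) \<le> ereal t} = {..<k div d}"
    using \<open>k div d \<le> length xs div d\<close> by (auto simp del: mult_Suc)
  then have "length (filter (expired_word t)
      (map (\<lambda>j. Time (expi (xs ! (Suc j * d - 1)))) [0..<length xs div d])) = k div d"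
    by (simp add: length_filter_conv_card del: mult_Suc cong: conj_cong)
  then show ?thesis
    by (simp add: summary_def Let_def d_def[symmetric] k_def[symmetric] del: mult_Suc)
qed

text \<open>Sorted insertion times make the items inserted by time \<open>t\<close> the prefix
  \<open>ys\<close>; the active items are its unexpired ones.\<close>

lemma n_active_eq:
  fixes t :: real
  assumes "sorted (map ins xs)"
  defines "ys \<equiv> takeWhile (\<lambda>x. ins x \<le> t) xs"
  shows "n_active xs t = length ys - length (filter (\<lambda>x. expi x \<le> ereal t) ys)"
proof -
  have "n_active xs t = length (filter (\<lambda>x. active x t) xs)"
    by (simp add: n_active_def length_filter_conv_card)
  also have "filter (\<lambda>x. active x t) xs = filter (\<lambda>x. \<not> expi x \<le> ereal t) ys"
    unfolding ys_def filter_le_eq_takeWhile[OF assms(1), symmetric]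
    by (simp add: active_def not_le conj_commute)
  finally show ?thesis
    using sum_length_filter_compl[of "\<lambda>x. expi x \<le> ereal t" ys] by simp
qed

lemma estimate_checkpoint_alg:
  assumes "0 \<le> \<epsilon>" "consistent_stream xs"
  shows "estimate_at (checkpoint_alg \<epsilon>) xs t \<le> n_active xs t"
    and "real (n_active xs t) \<le> real (estimate_at (checkpoint_alg \<epsilon>) xs t) + \<epsilon> * real (length xs)"
proof -
  define ys where "ys = takeWhile (\<lambda>x. ins x \<le> t) xs"
  define m where "m = length ys"
  define d where "d = spacing \<epsilon> m"
  define k where "k = length (filter (\<lambda>x. expi x \<le> ereal t) ys)"
  have "sorted (map ins xs)" and sorted: "sorted (map expi xs)"
    using assms(2) by (auto simp: consistent_stream_def expiration_stream_def)
  then have n_active: "n_active xs t = m - k"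
    by (simp add: n_active_eq m_def k_def ys_def)
  have "sorted (map expi ys)"
    unfolding ys_def by (metis sorted sorted_wrt_take take_map takeWhile_eq_take)
  then have estimate: "estimate_at (checkpoint_alg \<epsilon>) xs t = Suc m - Suc (k div d) * d"
    using summary_estimate_summary[of ys \<epsilon> t] memory_checkpoint_alg[OF assms(1), of ys]
    by (simp add: estimate_at_def ys_def[symmetric] checkpoint_alg_def m_def d_def k_def Let_def)
  have "0 < d" by (simp add: d_def)
  \<comment> \<open>Rounding \<open>k + 1\<close> up to a multiple of \<open>d\<close> adds at most
    \<open>d - 1\<close>.\<close>
  have "k = k div d * d + k mod d" "k mod d < d" using \<open>0 < d\<close> by simp_all
  moreover have "Suc (k div d) * d = k div d * d + d" by simp
  ultimately have bounds: "Suc k \<le> Suc (k div d) * d" "Suc (k div d) * d \<le> k + d"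
    by linarith+
  show "estimate_at (checkpoint_alg \<epsilon>) xs t \<le> n_active xs t"
    using bounds(1) unfolding n_active estimate by linarith
  \<comment> \<open>The 1 gained here cancels the \<open>+ 1\<close> in
    \<open>spacing_upper\<close>, leaving an error of at most \<open>\<epsilon> * m\<close>.\<close>
  have "n_active xs t + 1 \<le> estimate_at (checkpoint_alg \<epsilon>) xs t + d"
    using bounds(2) \<open>0 < d\<close> unfolding n_active estimate by linarith
  moreover have "real d \<le> \<epsilon> * real m + 1"
    unfolding d_def by (rule spacing_upper[OF assms(1)])
  moreover have "\<epsilon> * real m \<le> \<epsilon> * real (length xs)"
    using assms(1) by (intro mult_left_mono) (auto simp: m_def ys_def length_takeWhile_le)
  ultimately show "real (n_active xs t)
      \<le> real (estimate_at (checkpoint_alg \<epsilon>) xs t) + \<epsilon> * real (length xs)"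
    by linarith
qed

theorem theorem5p1:
  "\<exists>(C::real) (p::nat poly). \<forall>\<epsilon>::real. 0 < \<epsilon> \<and> \<epsilon> \<le> 1 / 2 \<longrightarrow>
     (\<exists>A. \<forall>(n::nat) xs. consistent_stream xs \<and> length xs = n \<longrightarrow>
        space_bounded A xs (C / \<epsilon>) (poly p n) \<and>
        (\<forall>t. estimate_at A xs t \<le> n_active xs t \<and>
             real (n_active xs t) \<le> real (estimate_at A xs t) + \<epsilon> * real n))"
proof (rule exI[of _ 3], rule exI[of _ "[:0, 1:]"], intro allI impI)
  fix \<epsilon> :: real
  assume \<epsilon>: "0 < \<epsilon> \<and> \<epsilon> \<le> 1 / 2"
  \<comment> \<open>The counter never exceeds the stream length, so the identity polynomial
    \<open>[:0, 1:]\<close> bounds it.\<close>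
  have "space_bounded (checkpoint_alg \<epsilon>) xs (3 / \<epsilon>) (poly [:0, 1:] (length xs))" for xs
    using \<epsilon> by (auto simp: space_bounded_def memory_checkpoint_alg
        intro: length_summary admissible_summary)
  then show "\<exists>A. \<forall>(n::nat) xs. consistent_stream xs \<and> length xs = n \<longrightarrow>
        space_bounded A xs (3 / \<epsilon>) (poly [:0, 1:] n) \<and>
        (\<forall>t. estimate_at A xs t \<le> n_active xs t \<and>
             real (n_active xs t) \<le> real (estimate_at A xs t) + \<epsilon> * real n)"
    using \<epsilon> estimate_checkpoint_alg[of \<epsilon>]
    by (intro exI[of _ "checkpoint_alg \<epsilon>"]) auto
qed

end
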